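(* Let $\sigma:\Sigma\to\Sigma$ be a topologically mixing one-sided subshift of finite type and let $A\in C^\theta(\hat\Sigma)$. Then there exists a sub-action $u_A\in C^\theta(\Sigma,\mathbb R^-)$ for $A$ such that, for any other sub-action $u\in C^0(\Sigma,\mathbb R^-)$ for $A$, one has $u_A\ge u$ on $\Sigma$.
   Context: Let $\mathbf M$ be an $r\times r$ matrix with entries in $\{0,1\}$. The one-sided subshift of finite type is $\Sigma=\{\mathbf x=(x_0,x_1,\ldots)\in\{1,\ldots,r\}^{\mathbb N}:\mathbf M(x_j,x_{j+1})=1\ \forall j\ge 0\}$ (nonempty), with the left shift $\sigma(x_0,x_1,\ldots)=(x_1,x_2,\ldots)$. Fix $\lambda\in(0,1)$; $\Sigma$ has the metric $d(\mathbf x,\bar{\mathbf x})=\lambda^{k}$, $k=\min\{j:x_j\ne\bar x_j\}$ (and $d(\mathbf x,\mathbf x)=0$). The dual space is $\Sigma^*=\{\mathbf y=(\ldots,y_1,y_0)\in\{1,\ldots,r\}^{\mathbb N}:\mathbf M(y_{j+1},y_j)=1\ \forall j\ge0\}$, with the analogous metric. Let $\hat\Sigma=\{(\mathbf y,\mathbf x)\in\Sigma^*\times\Sigma:\mathbf M(y_0,x_0)=1\}$, with the maximum metric induced from the product. Define $\tau:\hat\Sigma\to\Sigma$ by $\tau(\mathbf y,\mathbf x)=\tau_{\mathbf y}(\mathbf x)=(y_0,x_0,x_1,\ldots)$. $C^0(\cdot)$ denotes real-valued continuous functions and $C^\theta(\cdot)$ (with $\theta>0$) the $\theta$-Hölder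 ones; $C^0(\Sigma,\mathbb R^-)$ and $C^\theta(\Sigma,\mathbb R^-)$ denote those with values in $\mathbb R^-=(-\infty,0]$. The map $\sigma$ is topologically mixing if for any nonempty open $D,E\subset\Sigma$ there is an integer $K>0$ with $\sigma^k(D)\cap E\ne\emptyset$ for all $k>K$. The set $\mathcal M_0$ of holonomic probabilities is the set of Borel probability measures $\hat\mu$ on $\hat\Sigma$ such that $\int f(\tau_{\mathbf y}(\mathbf x))\,d\hat\mu(\mathbf y,\mathbf x)=\int f(\mathbf x)\,d\hat\mu(\mathbf y,\mathbf x)$ for all $f\in C^0(\Sigma)$. For $A\in C^0(\hat\Sigma)$, $\beta_A=\max_{\hat\mu\in\mathcal M_0}\int_{\hat\Sigma}A\,d\hat\mu$. A sub-action for $A$ is a function $u\in C^0(\Sigma)$ with $u(\mathbf x)\le u(\tau_{\mathbf y}(\mathbf x))-A(\mathbf y,\mathbf x)+\beta_A$ for all $(\mathbf y,\mathbf x)\in\hat\Sigma$. *)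

theory Defs
  imports "HOL-Probability.Probability"
begin

text \<open>
  The alphabet \<open>{1,\<dots>,r}\<close> is a finite index type \<open>'r\<close>, so that an \<open>r \<times> r\<close> matrix is an element
  of \<^typ>\<open>nat ^ 'r ^ 'r\<close> and \<open>M(i,j)\<close> is \<open>M $ i $ j\<close>.
\<close>

definition zero_one_matrix :: "nat ^ 'r ^ 'r \<Rightarrow> bool" where
  "zero_one_matrix M \<longleftrightarrow> (\<forall>i j. M $ i $ j \<in> {0, 1})"

definition sft :: "nat ^ 'r ^ 'r \<Rightarrow> (nat \<Rightarrow> 'r::finite) set" where
  "sft M = {x. \<forall>j. M $ x j $ x (Suc j) = 1}"

text \<open>A point \<open>(\<dots>, y\<^sub>1, y\<^sub>0)\<close> of the dual space is the function \<open>j \<mapsto> y\<^sub>j\<close>.\<close>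

definition dual_sft :: "nat ^ 'r ^ 'r \<Rightarrow> (nat \<Rightarrow> 'r::finite) set" where
  "dual_sft M = {y. \<forall>j. M $ y (Suc j) $ y j = 1}"

definition hat_sft :: "nat ^ 'r ^ 'r \<Rightarrow> ((nat \<Rightarrow> 'r) \<times> (nat \<Rightarrow> 'r::finite)) set" where
  "hat_sft M = {(y, x). y \<in> dual_sft M \<and> x \<in> sft M \<and> M $ y 0 $ x 0 = 1}"

definition left_shift :: "(nat \<Rightarrow> 'r) \<Rightarrow> nat \<Rightarrow> 'r" where
  "left_shift x = (\<lambda>j. x (Suc j))"

definition tau :: "(nat \<Rightarrow> 'r) \<times> (nat \<Rightarrow> 'r) \<Rightarrow> nat \<Rightarrow> 'r" where
  "tau = (\<lambda>(y, x). case_nat (y 0) x)"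

definition seq_dist :: "real \<Rightarrow> (nat \<Rightarrow> 'r) \<Rightarrow> (nat \<Rightarrow> 'r) \<Rightarrow> real" where
  "seq_dist l x x' = (if x = x' then 0 else l ^ (LEAST j. x j \<noteq> x' j))"

definition hat_dist ::
  "real \<Rightarrow> (nat \<Rightarrow> 'r) \<times> (nat \<Rightarrow> 'r) \<Rightarrow> (nat \<Rightarrow> 'r) \<times> (nat \<Rightarrow> 'r) \<Rightarrow> real" where
  "hat_dist l = (\<lambda>(y, x) (y', x'). max (seq_dist l y y') (seq_dist l x x'))"

lemma seq_dist_ultra:
  assumes "0 < l" "l < 1"
  shows "seq_dist l x z \<le> max (seq_dist l x y) (seq_dist l y z)"
proof (cases "x = z \<or> x = y \<or> y = z")
  case True
  then show ?thesis using assms by (auto simp: seq_dist_def le_max_iff_disj)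
next
  case False
  define k where "k = (LEAST j. x j \<noteq> z j)"
  have k: "x k \<noteq> z k"
    unfolding k_def by (rule LeastI_ex) (use False in auto)
  then consider "x k \<noteq> y k" | "y k \<noteq> z k" by force
  then show ?thesis
  proof cases
    case 1
    then have "(LEAST j. x j \<noteq> y j) \<le> k" by (rule Least_le)
    then have "l ^ k \<le> l ^ (LEAST j. x j \<noteq> y j)"
      using assms by (intro power_decreasing) auto
    then show ?thesis using False by (auto simp: seq_dist_def k_def)
  next
    case 2
    then have "(LEAST j. y j \<noteq> z j) \<le> k" by (rule Least_le)
    then have "l ^ k \<le> l ^ (LEAST j. y j \<noteq> z j)"
      using assms by (intro power_decreasing) auto
    then show ?thesis using False by (auto simp: seq_dist_def k_def)
  qed
qed

lemma seq_dist_nonneg: "0 < l \<Longrightarrow> 0 \<le> seq_dist l x y"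
  by (simp add: seq_dist_def)

lemma seq_dist_eq_0: "0 < l \<Longrightarrow> seq_dist l x y = 0 \<longleftrightarrow> x = y"
  by (auto simp: seq_dist_def)

lemma seq_dist_commute: "seq_dist l x y = seq_dist l y x"
  by (auto simp: seq_dist_def intro!: arg_cong[where f = "\<lambda>n. l ^ n"] arg_cong[where f = Least])

lemma Metric_space_seq_dist:
  assumes "0 < l" "l < 1"
  shows "Metric_space S (seq_dist l)"
proof
  fix x y z :: "nat \<Rightarrow> 'a"
  show "0 \<le> seq_dist l x y" by (rule seq_dist_nonneg) fact
  show "seq_dist l x y = seq_dist l y x" by (rule seq_dist_commute)
  show "seq_dist l x y = 0 \<longleftrightarrow> x = y" by (rule seq_dist_eq_0) fact
  show "seq_dist l x z \<le> seq_dist l x y + seq_dist l y z"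
    using seq_dist_ultra[OF assms, of x z y] seq_dist_nonneg[OF assms(1), of x y]
      seq_dist_nonneg[OF assms(1), of y z] by linarith
qed

lemma Metric_space_hat_dist:
  assumes "0 < l" "l < 1"
  shows "Metric_space S (hat_dist l)"
proof
  fix p q s :: "(nat \<Rightarrow> 'a) \<times> (nat \<Rightarrow> 'a)"
  obtain p1 p2 q1 q2 s1 s2 where pqs: "p = (p1, p2)" "q = (q1, q2)" "s = (s1, s2)"
    by (metis surj_pair)
  note nonneg = seq_dist_nonneg[OF assms(1)]
  show "0 \<le> hat_dist l p q"
    using nonneg[of p1 q1] by (simp add: hat_dist_def pqs max_def)
  show "hat_dist l p q = hat_dist l q p"
    by (simp add: hat_dist_def pqs seq_dist_commute[of l])
  show "hat_dist l p q = 0 \<longleftrightarrow> p = q"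
    using nonneg[of p1 q1] nonneg[of p2 q2] seq_dist_eq_0[OF assms(1), of p1 q1]
      seq_dist_eq_0[OF assms(1), of p2 q2]
    by (auto simp: hat_dist_def pqs max_def)
  show "hat_dist l p s \<le> hat_dist l p q + hat_dist l q s"
    using seq_dist_ultra[OF assms, of p1 s1 q1] seq_dist_ultra[OF assms, of p2 s2 q2]
      nonneg[of p1 q1] nonneg[of p2 q2] nonneg[of q1 s1] nonneg[of q2 s2]
    by (simp add: hat_dist_def pqs) linarith
qed

definition sft_top :: "real \<Rightarrow> nat ^ 'r ^ 'r \<Rightarrow> (nat \<Rightarrow> 'r::finite) topology" where
  "sft_top l M = Metric_space.mtopology (sft M) (seq_dist l)"

definition hat_top ::
  "real \<Rightarrow> nat ^ 'r ^ 'r \<Rightarrow> ((nat \<Rightarrow> 'r) \<times> (nat \<Rightarrow> 'r::finite)) topology" where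
  "hat_top l M = Metric_space.mtopology (hat_sft M) (hat_dist l)"

definition topologically_mixing :: "'a topology \<Rightarrow> ('a \<Rightarrow> 'a) \<Rightarrow> bool" where
  "topologically_mixing X T \<longleftrightarrow>
     (\<forall>D E. openin X D \<and> D \<noteq> {} \<and> openin X E \<and> E \<noteq> {} \<longrightarrow>
        (\<exists>K>0. \<forall>k>K. (T ^^ k) ` D \<inter> E \<noteq> {}))"

definition holder_on ::
  "'a set \<Rightarrow> ('a \<Rightarrow> 'a \<Rightarrow> real) \<Rightarrow> real \<Rightarrow> ('a \<Rightarrow> real) \<Rightarrow> bool" where
  "holder_on S d \<theta> f \<longleftrightarrow> (\<exists>C. \<forall>x\<in>S. \<forall>x'\<in>S. \<bar>f x - f x'\<bar> \<le> C * d x x' powr \<theta>)"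

definition borel_of_top :: "'a topology \<Rightarrow> 'a measure" where
  "borel_of_top X = sigma (topspace X) {U. openin X U}"

definition holonomic ::
  "real \<Rightarrow> nat ^ 'r ^ 'r \<Rightarrow> ((nat \<Rightarrow> 'r) \<times> (nat \<Rightarrow> 'r::finite)) measure set" where
  "holonomic l M =
     {\<mu>. prob_space \<mu> \<and> sets \<mu> = sets (borel_of_top (hat_top l M)) \<and>
         (\<forall>f. continuous_map (sft_top l M) euclideanreal f \<longrightarrow>
              (\<integral>p. f (tau p) \<partial>\<mu>) = (\<integral>p. f (snd p) \<partial>\<mu>))}"

text \<open>
  The maximum of \<open>\<integral> A d\<mu>\<close> over the holonomic probabilities is written as a supremum. For continuous
  \<open>A\<close> it is attained, the holonomic probabilities being weak-\<open>*\<close> compact, so the two agree.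
\<close>

definition beta ::
  "real \<Rightarrow> nat ^ 'r ^ 'r \<Rightarrow> ((nat \<Rightarrow> 'r) \<times> (nat \<Rightarrow> 'r::finite) \<Rightarrow> real) \<Rightarrow> real" where
  "beta l M A = (SUP \<mu>\<in>holonomic l M. \<integral>p. A p \<partial>\<mu>)"

definition sub_action ::
  "real \<Rightarrow> nat ^ 'r ^ 'r \<Rightarrow> ((nat \<Rightarrow> 'r) \<times> (nat \<Rightarrow> 'r::finite) \<Rightarrow> real)
     \<Rightarrow> ((nat \<Rightarrow> 'r) \<Rightarrow> real) \<Rightarrow> bool" where
  "sub_action l M A u \<longleftrightarrow>
     continuous_map (sft_top l M) euclideanreal u \<and>
     (\<forall>(y, x)\<in>hat_sft M. u x \<le> u (tau (y, x)) - A (y, x) + beta l M A)"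

end

theory Submission
  imports Defs
begin

text \<open>
  Write \<open>c = \<beta>\<^sub>A - A\<close>. A sub-action is a continuous \<open>u\<close> with
  \<open>u x \<le> c (y, x) + u (\<tau>\<^sub>y x)\<close>. Iterating this along a chain of inverse branches
  \<open>x, \<tau>\<^sub>y x, \<tau>\<^sub>z (\<tau>\<^sub>y x), \<dots>\<close> and dropping the last value of \<open>u\<close>, which is at most \<open>0\<close>, bounds
  \<open>u x\<close> by the total cost of the chain. So every nonpositive sub-action lies below
  \<open>u\<^sub>A x\<close>, the infimum of the costs of all finite chains starting at \<open>x\<close>
  (\<open>sub_action_le_chain_cost\<close>). The empty chain has cost \<open>0\<close>, hence \<open>u\<^sub>A \<le> 0\<close>; prefixing one
  branch to a chain shows that \<open>u\<^sub>A\<close> itself satisfies the sub-action inequality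
  (\<open>best_cost_step\<close>). The point is that \<open>u\<^sub>A\<close> is finite and Hoelder continuous.

  Hoelder continuity comes from contraction. If \<open>x\<close> and \<open>x'\<close> have the same first symbol, a chain from
  \<open>x\<close> is also a chain from \<open>x'\<close>, and after \<open>i\<close> branches the two trajectories are at distance
  \<open>\<lambda>\<^sup>i d(x, x')\<close>, so the costs differ by at most a geometric series times \<open>d(x, x')\<^sup>\<theta>\<close>
  (\<open>chain_change_start\<close>). If the first symbols differ, the distance is \<open>1\<close> and boundedness of
  \<open>u\<^sub>A\<close> is enough.

  Boundedness from below is where the definition of \<open>\<beta>\<^sub>A\<close> enters. The uniform measure on the steps
  of a closed chain is holonomic, so the mean of \<open>A\<close> over such a chain is at most \<open>\<beta>\<^sub>A\<close>: closed chains
  have nonnegative cost (\<open>closed_chain_cost_nonneg\<close>). An arbitrary chain is nearly closed: by mixing, the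
  first symbol of \<open>x\<close> can be joined to the first symbol of the end of the chain by a word of length at
  most some fixed \<open>N\<close>, and repeating this word followed by the symbols that the chain prepends gives a
  periodic point \<open>p\<close> with the same first symbol as \<open>x\<close>. The same chain started at \<open>p\<close> closes up after
  at most \<open>N\<close> more branches (\<open>chain_closing_point\<close>, \<open>chain_undo_shift\<close>). Replacing \<open>x\<close> by \<open>p\<close> and adding
  these branches changes the cost by a bounded amount, whatever the length of the chain.
\<close>

section \<open>Continuity for the sequence metrics\<close>

lemma seq_dist_le_1:
  assumes "0 < l" "l < 1"
  shows "seq_dist l x x' \<le> 1"
  using assms by (simp add: seq_dist_def power_le_one)

lemma seq_dist_eq_1:
  assumes "x 0 \<noteq> x' 0"
  shows "seq_dist l x x' = 1"
proof -
  have "(LEAST j. x j \<noteq> x' j) = 0"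
    by (rule Least_eq_0) (rule assms)
  then show ?thesis using assms by (auto simp: seq_dist_def)
qed

lemma seq_dist_case_nat: "seq_dist l (case_nat a x) (case_nat a x') = l * seq_dist l x x'"
proof (cases "x = x'")
  case True
  then show ?thesis by (simp add: seq_dist_def)
next
  case False
  then obtain n where n: "x n \<noteq> x' n" by auto
  have "(LEAST j. case_nat a x j \<noteq> case_nat a x' j) = Suc (LEAST j. x j \<noteq> x' j)"
    using Least_Suc[of "\<lambda>j. case_nat a x j \<noteq> case_nat a x' j" "Suc n"] n by simp
  moreover have "case_nat a x \<noteq> case_nat a x'"
    using n by (metis old.nat.simps(5))
  ultimately show ?thesis using False by (simp add: seq_dist_def)
qed

lemma hat_dist_le_1:
  assumes "0 < l" "l < 1"
  shows "hat_dist l p q \<le> 1"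
  using seq_dist_le_1[OF assms] by (auto simp: hat_dist_def split: prod.splits)

lemma hat_dist_nonneg: "0 < l \<Longrightarrow> 0 \<le> hat_dist l p q"
  by (auto simp: hat_dist_def le_max_iff_disj seq_dist_nonneg split: prod.splits)

lemma hat_dist_same_fst: "0 < l \<Longrightarrow> hat_dist l (y, x) (y, x') = seq_dist l x x'"
  using seq_dist_nonneg[of l x x'] by (simp add: hat_dist_def seq_dist_def[of l y y])

text \<open>
  If the prepended symbols agree, prepending multiplies the distance of the second components by \<open>l\<close>; if they
  differ, the first components are already at the maximal distance \<open>1\<close>.
\<close>

lemma tau_dist_le:
  assumes "0 < l" "l < 1"
  shows "seq_dist l (tau p) (tau q) \<le> hat_dist l p q"
proof -
  obtain y x y' x' where pq: "p = (y, x)" "q = (y', x')" by (metis surj_pair)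
  show ?thesis
  proof (cases "y 0 = y' 0")
    case True
    have "l * seq_dist l x x' \<le> 1 * seq_dist l x x'"
      using assms seq_dist_nonneg[of l x x'] by (intro mult_right_mono) auto
    then show ?thesis using True by (simp add: tau_def pq hat_dist_def seq_dist_case_nat)
  next
    case False
    then have "hat_dist l p q \<ge> 1"
      by (simp add: hat_dist_def pq seq_dist_eq_1)
    then show ?thesis using seq_dist_le_1[OF assms, of "tau p" "tau q"] by linarith
  qed
qed

lemma tau_in_sft: "p \<in> hat_sft M \<Longrightarrow> tau p \<in> sft M"
  by (auto simp: hat_sft_def sft_def tau_def split: nat.splits)

lemma continuous_map_nonexpansive:
  assumes "Metric_space S d" "Metric_space S' d'"
    and "\<And>p. p \<in> S \<Longrightarrow> f p \<in> S'"
    and "\<And>p q. p \<in> S \<Longrightarrow> q \<in> S \<Longrightarrow> d' (f p) (f q) \<le> d p q"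
  shows "continuous_map (Metric_space.mtopology S d) (Metric_space.mtopology S' d') f"
proof -
  interpret A: Metric_space S d by fact
  interpret B: Metric_space S' d' by fact
  show ?thesis
    unfolding B.continuous_map_to_metric
  proof (intro ballI allI impI)
    fix x and e :: real assume x: "x \<in> topspace A.mtopology" and e: "e > 0"
    have "f y \<in> B.mball (f x) e" if "y \<in> A.mball x e" for y
      using that assms(3)[of x] assms(3)[of y] assms(4)[of x y] by auto
    then show "\<exists>U. openin A.mtopology U \<and> x \<in> U \<and> (\<forall>y\<in>U. f y \<in> B.mball (f x) e)"
      using x e by (intro exI[of _ "A.mball x e"]) auto
  qed
qed

lemma holder_on_nonneg_constant:
  assumes "holder_on S d \<theta> f"
  obtains C where "C \<ge> 0"
    and "\<And>x x'. x \<in> S \<Longrightarrow> x' \<in> S \<Longrightarrow> \<bar>f x - f x'\<bar> \<le> C * d x x' powr \<theta>"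
proof -
  obtain C where C: "\<And>x x'. x \<in> S \<Longrightarrow> x' \<in> S \<Longrightarrow> \<bar>f x - f x'\<bar> \<le> C * d x x' powr \<theta>"
    using assms unfolding holder_on_def by blast
  have "\<bar>f x - f x'\<bar> \<le> \<bar>C\<bar> * d x x' powr \<theta>" if "x \<in> S" "x' \<in> S" for x x'
    using C[OF that] mult_right_mono[OF abs_ge_self powr_ge_zero, of C "d x x'" \<theta>] by linarith
  then show ?thesis using that[of "\<bar>C\<bar>"] by simp
qed

lemma holder_on_bounded:
  assumes "holder_on S d \<theta> f" "0 \<le> \<theta>"
    and d: "\<And>x x'. 0 \<le> d x x'" "\<And>x x'. d x x' \<le> 1"
  shows "\<exists>B. \<forall>x\<in>S. \<bar>f x\<bar> \<le> B"
proof (cases "S = {}")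
  case False
  then obtain x0 where x0: "x0 \<in> S" by auto
  obtain C where C: "C \<ge> 0"
    "\<And>x x'. x \<in> S \<Longrightarrow> x' \<in> S \<Longrightarrow> \<bar>f x - f x'\<bar> \<le> C * d x x' powr \<theta>"
    using holder_on_nonneg_constant[OF assms(1)] by blast
  have "\<bar>f x\<bar> \<le> \<bar>f x0\<bar> + C" if "x \<in> S" for x
  proof -
    have "d x x0 powr \<theta> \<le> 1" using assms(2) d[of x x0] by (simp add: powr_le1)
    then have "C * d x x0 powr \<theta> \<le> C * 1" using C(1) by (intro mult_left_mono)
    then show ?thesis using C(2)[OF that x0] by linarith
  qed
  then show ?thesis by blast
qed simp

lemma holder_on_continuous_map:
  assumes "Metric_space S d" and "0 < \<theta>" and "holder_on S d \<theta> f"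
  shows "continuous_map (Metric_space.mtopology S d) euclideanreal f"
proof -
  interpret A: Metric_space S d by fact
  obtain C0 where C0: "C0 \<ge> 0"
    "\<And>x x'. x \<in> S \<Longrightarrow> x' \<in> S \<Longrightarrow> \<bar>f x - f x'\<bar> \<le> C0 * d x x' powr \<theta>"
    using holder_on_nonneg_constant[OF assms(3)] by blast
  define C where "C = C0 + 1"
  have C: "C > 0" using C0(1) by (simp add: C_def)
  have fC: "\<bar>f x - f x'\<bar> \<le> C * d x x' powr \<theta>" if "x \<in> S" "x' \<in> S" for x x'
    using C0(2)[OF that] powr_ge_zero[of "d x x'" \<theta>] unfolding C_def distrib_right by linarith
  have "continuous_map A.mtopology (Met_TC.mtopology :: real topology) f"
    unfolding Met_TC.continuous_map_to_metric
  proof (intro ballI allI impI)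
    fix x and e :: real assume x: "x \<in> topspace A.mtopology" and e: "e > 0"
    define \<delta> where "\<delta> = (e / C) powr (1 / \<theta>)"
    have \<delta>: "\<delta> > 0" "\<delta> powr \<theta> = e / C"
      using e C assms(2) by (auto simp: \<delta>_def powr_powr)
    have "f y \<in> Met_TC.mball (f x) e" if "y \<in> A.mball x \<delta>" for y
    proof -
      have y: "y \<in> S" "d x y < \<delta>" "x \<in> S" using that by auto
      have "d x y powr \<theta> < \<delta> powr \<theta>"
        using y(2) assms(2) by (intro powr_less_mono2) auto
      then have "C * d x y powr \<theta> < e"
        using C \<delta>(2) by (simp add: field_simps)
      then show ?thesis using fC[OF y(3) y(1)] by (simp add: dist_real_def)
    qed
    then show "\<exists>U. openin A.mtopology U \<and> x \<in> U \<and> (\<forall>y\<in>U. f y \<in> Met_TC.mball (f x) e)"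
      using x \<delta>(1) by (intro exI[of _ "A.mball x \<delta>"]) auto
  qed
  then show ?thesis by simp
qed

lemma continuous_map_borel_of_top:
  assumes "continuous_map X euclideanreal f"
  shows "f \<in> borel_measurable (borel_of_top X)"
proof (rule borel_measurableI)
  fix S :: "real set" assume "open S"
  then have "openin X {x \<in> topspace X. f x \<in> S}"
    using openin_continuous_map_preimage[OF assms, of S] by simp
  moreover have "f -` S \<inter> space (borel_of_top X) = {x \<in> topspace X. f x \<in> S}"
    by (auto simp: borel_of_top_def space_measure_of_conv)
  moreover have "{U. openin X U} \<subseteq> Pow (topspace X)"
    using openin_subset by auto
  ultimately show "f -` S \<inter> space (borel_of_top X) \<in> sets (borel_of_top X)"
    by (auto simp: borel_of_top_def)
qed

lemma space_borel_of_hat_top: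
  assumes "0 < l" "l < 1"
  shows "space (borel_of_top (hat_top l M)) = hat_sft M"
  by (simp add: borel_of_top_def hat_top_def space_measure_of_conv
      Metric_space.topspace_mtopology[OF Metric_space_hat_dist[OF assms]])

section \<open>Chains of inverse branches\<close>

text \<open>
  A chain from \<open>x\<close> lists the points of the dual space whose branches are applied, the first entry being applied
  first. The next point depends only on the first symbol of an entry, but the potential sees the whole entry.
\<close>

primrec chain :: "nat ^ 'r ^ 'r \<Rightarrow> (nat \<Rightarrow> 'r::finite) \<Rightarrow> (nat \<Rightarrow> 'r) list \<Rightarrow> bool" where
  "chain M x [] \<longleftrightarrow> True"
| "chain M x (y # ys) \<longleftrightarrow> (y, x) \<in> hat_sft M \<and> chain M (tau (y, x)) ys"

primrec chain_end :: "(nat \<Rightarrow> 'r) \<Rightarrow> (nat \<Rightarrow> 'r) list \<Rightarrow> nat \<Rightarrow> 'r" where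
  "chain_end x [] = x"
| "chain_end x (y # ys) = chain_end (tau (y, x)) ys"

primrec chain_cost ::
  "((nat \<Rightarrow> 'r) \<times> (nat \<Rightarrow> 'r) \<Rightarrow> real) \<Rightarrow> (nat \<Rightarrow> 'r) \<Rightarrow> (nat \<Rightarrow> 'r) list \<Rightarrow> real" where
  "chain_cost c x [] = 0"
| "chain_cost c x (y # ys) = c (y, x) + chain_cost c (tau (y, x)) ys"

text \<open>
  The infimum includes the empty chain, of cost \<open>0\<close>. It is the value of an optimal stopping problem, where the
  player may stop after any number of branches.
\<close>

definition best_cost ::
  "nat ^ 'r ^ 'r \<Rightarrow> ((nat \<Rightarrow> 'r) \<times> (nat \<Rightarrow> 'r) \<Rightarrow> real) \<Rightarrow> (nat \<Rightarrow> 'r::finite) \<Rightarrow> real" where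
  "best_cost M c x = (INF ys\<in>{ys. chain M x ys}. chain_cost c x ys)"

lemma chain_append: "chain M x (ys @ zs) \<longleftrightarrow> chain M x ys \<and> chain M (chain_end x ys) zs"
  by (induction ys arbitrary: x) auto

lemma chain_end_append: "chain_end x (ys @ zs) = chain_end (chain_end x ys) zs"
  by (induction ys arbitrary: x) auto

lemma chain_cost_append:
  "chain_cost c x (ys @ zs) = chain_cost c x ys + chain_cost c (chain_end x ys) zs"
  by (induction ys arbitrary: x) auto

lemma chain_end_in_sft: "chain M x ys \<Longrightarrow> x \<in> sft M \<Longrightarrow> chain_end x ys \<in> sft M"
  by (induction ys arbitrary: x) (auto intro: tau_in_sft)

text \<open>
  Together with the next lemma, this says that a chain of length \<open>n\<close> prepends a word of length \<open>n\<close> that is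
  determined by the chain alone.
\<close>

lemma chain_end_tail: "chain_end x ys (j + length ys) = x j"
proof (induction ys arbitrary: x j)
  case (Cons y ys)
  show ?case using Cons[of "tau (y, x)" "Suc j"] by (simp add: tau_def)
qed simp

lemma chain_end_prefix: "j < length ys \<Longrightarrow> chain_end x ys j = chain_end x' ys j"
proof (induction ys arbitrary: x x')
  case (Cons y ys)
  show ?case
  proof (cases "j < length ys")
    case True
    then show ?thesis using Cons.IH by simp
  next
    case False
    then have "j = 0 + length ys" using Cons.prems by simp
    then show ?thesis
      using chain_end_tail[of "tau (y, x)" ys 0] chain_end_tail[of "tau (y, x')" ys 0]
      by (simp add: tau_def)
  qed
qed simp

lemma chain_nth:
  "chain M x ys \<Longrightarrow> k < length ys \<Longrightarrow> (ys ! k, chain_end x (take k ys)) \<in> hat_sft M"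
  by (induction ys arbitrary: x k) (auto simp: less_Suc_eq_0_disj)

lemma chain_end_take_Suc:
  "k < length ys \<Longrightarrow> chain_end x (take (Suc k) ys) = tau (ys ! k, chain_end x (take k ys))"
  by (simp add: take_Suc_conv_app_nth chain_end_append)

lemma chain_cost_eq_sum:
  "chain_cost c x ys = (\<Sum>k<length ys. c (ys ! k, chain_end x (take k ys)))"
  by (induction ys arbitrary: x) (auto simp: sum.lessThan_Suc_shift simp del: sum.lessThan_Suc)

lemma chain_cost_le:
  assumes "chain M x ys" and "\<And>p. p \<in> hat_sft M \<Longrightarrow> c p \<le> D"
  shows "chain_cost c x ys \<le> real (length ys) * D"
  using assms(1)
proof (induction ys arbitrary: x)
  case (Cons y ys)
  have "c (y, x) \<le> D" "chain_cost c (tau (y, x)) ys \<le> real (length ys) * D"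
    using Cons.prems Cons.IH assms(2) by auto
  then show ?case by (simp add: algebra_simps)
qed simp

text \<open>
  The sub-action inequality telescopes along the chain, and the remaining value of \<open>u\<close> at its end is nonpositive.
\<close>

lemma sub_action_le_chain_cost:
  assumes "sub_action l M A u" and "\<And>x. x \<in> sft M \<Longrightarrow> u x \<le> 0"
  shows "chain M x ys \<Longrightarrow> x \<in> sft M \<Longrightarrow> u x \<le> chain_cost (\<lambda>p. beta l M A - A p) x ys"
proof (induction ys arbitrary: x)
  case Nil
  then show ?case using assms(2) by simp
next
  case (Cons y ys)
  have "(y, x) \<in> hat_sft M" using Cons.prems by simp
  then have "u x \<le> u (tau (y, x)) - A (y, x) + beta l M A"
    using assms(1) unfolding sub_action_def by blast
  moreover have "u (tau (y, x)) \<le> chain_cost (\<lambda>p. beta l M A - A p) (tau (y, x)) ys"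
    using Cons.prems by (intro Cons.IH) (auto intro: tau_in_sft)
  ultimately show ?case by simp
qed

lemma best_cost_le:
  assumes "\<And>ys. chain M x ys \<Longrightarrow> b \<le> chain_cost c x ys" and "chain M x ys"
  shows "best_cost M c x \<le> chain_cost c x ys"
  unfolding best_cost_def using assms by (intro cINF_lower bdd_belowI2[of _ b]) auto

lemma best_cost_greatest:
  assumes "\<And>ys. chain M x ys \<Longrightarrow> b \<le> chain_cost c x ys"
  shows "b \<le> best_cost M c x"
  unfolding best_cost_def using assms by (intro cINF_greatest) (auto intro: exI[of _ "[]"])

text \<open>
  A chain from \<open>\<tau>\<^sub>y x\<close> becomes a chain from \<open>x\<close> when \<open>y\<close> is put in front of it.
\<close>

lemma best_cost_step:
  assumes bdd: "\<And>ys. chain M x ys \<Longrightarrow> b \<le> chain_cost c x ys"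
    and p: "(y, x) \<in> hat_sft M"
  shows "best_cost M c x \<le> c (y, x) + best_cost M c (tau (y, x))"
proof -
  have "best_cost M c x - c (y, x) \<le> best_cost M c (tau (y, x))"
  proof (rule best_cost_greatest)
    fix ys assume "chain M (tau (y, x)) ys"
    then have "best_cost M c x \<le> chain_cost c x (y # ys)"
      using p by (intro best_cost_le[OF bdd]) auto
    then show "best_cost M c x - c (y, x) \<le> chain_cost c (tau (y, x)) ys" by simp
  qed
  then show ?thesis by simp
qed

text \<open>
  With the same entries \<open>y\<close>, the first step costs the two trajectories amounts differing by at most
  \<open>C d\<^sup>\<theta>\<close>, and every branch contracts the distance by \<open>l\<close>. Summing the geometric series with ratio
  \<open>l\<^sup>\<theta>\<close> gives the constant. Equal first symbols make the first branch admissible at both points, and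
  afterwards the first symbols agree because the same symbol has been prepended.
\<close>

lemma chain_change_start:
  assumes "0 < l" "l < 1" "0 < \<theta>" "0 \<le> C"
    and c: "\<And>p q. p \<in> hat_sft M \<Longrightarrow> q \<in> hat_sft M \<Longrightarrow> \<bar>c p - c q\<bar> \<le> C * hat_dist l p q powr \<theta>"
  shows "chain M x ys \<Longrightarrow> x \<in> sft M \<Longrightarrow> x' \<in> sft M \<Longrightarrow> x 0 = x' 0 \<Longrightarrow>
    chain M x' ys \<and>
    \<bar>chain_cost c x ys - chain_cost c x' ys\<bar> \<le> C / (1 - l powr \<theta>) * seq_dist l x x' powr \<theta>"
proof (induction ys arbitrary: x x')
  case Nil
  have "l powr \<theta> < 1 powr \<theta>" using assms by (intro powr_less_mono2) auto
  then show ?case using assms by simp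
next
  case (Cons y ys)
  have q: "l powr \<theta> < 1" using assms powr_less_mono2[of \<theta> l 1] by simp
  have h: "(y, x) \<in> hat_sft M" using Cons.prems by simp
  have h': "(y, x') \<in> hat_sft M" using h Cons.prems by (simp add: hat_sft_def)
  let ?d = "seq_dist l x x' powr \<theta>"
  have d: "seq_dist l (tau (y, x)) (tau (y, x')) powr \<theta> = l powr \<theta> * ?d"
    using assms seq_dist_nonneg[of l x x'] by (simp add: tau_def seq_dist_case_nat powr_mult)
  have ih: "chain M (tau (y, x')) ys \<and>
    \<bar>chain_cost c (tau (y, x)) ys - chain_cost c (tau (y, x')) ys\<bar>
      \<le> C / (1 - l powr \<theta>) * (l powr \<theta> * ?d)"
    unfolding d[symmetric]
    using Cons.prems by (intro Cons.IH tau_in_sft h h') (auto simp: tau_def)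
  have "\<bar>c (y, x) - c (y, x')\<bar> \<le> C * ?d"
    using c[OF h h'] assms by (simp add: hat_dist_same_fst)
  moreover have "C * ?d + C / (1 - l powr \<theta>) * (l powr \<theta> * ?d) = C / (1 - l powr \<theta>) * ?d"
    using q by (simp add: field_simps)
  ultimately show ?case using ih h' by simp linarith
qed

lemma holder_cost_change_start:
  assumes "0 < l" "l < 1" "0 < \<theta>" and "holder_on (hat_sft M) (hat_dist l) \<theta> A"
  shows "\<exists>H\<ge>0. \<forall>x x' ys. chain M x ys \<longrightarrow> x \<in> sft M \<longrightarrow> x' \<in> sft M \<longrightarrow> x 0 = x' 0 \<longrightarrow>
    chain M x' ys \<and> \<bar>chain_cost (\<lambda>p. b - A p) x ys - chain_cost (\<lambda>p. b - A p) x' ys\<bar>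
      \<le> H * seq_dist l x x' powr \<theta>"
proof -
  obtain C where C: "C \<ge> 0" "\<And>p q. p \<in> hat_sft M \<Longrightarrow> q \<in> hat_sft M \<Longrightarrow>
      \<bar>A p - A q\<bar> \<le> C * hat_dist l p q powr \<theta>"
    using holder_on_nonneg_constant[OF assms(4)] by blast
  have c: "\<bar>(b - A p) - (b - A q)\<bar> \<le> C * hat_dist l p q powr \<theta>"
    if "p \<in> hat_sft M" "q \<in> hat_sft M" for p q
    using C(2)[OF that] by simp
  have "l powr \<theta> < 1" using assms powr_less_mono2[of \<theta> l 1] by simp
  then have "0 \<le> C / (1 - l powr \<theta>)" using C(1) by simp
  then show ?thesis
    using chain_change_start[OF assms(1-3) C(1), where c = "\<lambda>p. b - A p"] c
    by (intro exI[of _ "C / (1 - l powr \<theta>)"]) blast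
qed

section \<open>Closed chains have nonnegative cost\<close>

text \<open>
  A supremum of reals bounds its members only over a set that is bounded above; here boundedness of \<open>A\<close>
  provides this. For a measure under which \<open>A\<close> is not integrable, the integral is \<open>0\<close> by convention, which
  \<open>\<bar>B\<bar>\<close> also bounds.
\<close>

lemma integral_holonomic_le_beta:
  assumes "0 < l" "l < 1"
    and B: "\<And>p. p \<in> hat_sft M \<Longrightarrow> \<bar>A p\<bar> \<le> B"
    and \<mu>: "\<mu> \<in> holonomic l M"
  shows "(\<integral>p. A p \<partial>\<mu>) \<le> beta l M A"
  unfolding beta_def
proof (rule cSUP_upper[OF \<mu>])
  have "(\<integral>p. A p \<partial>\<nu>) \<le> \<bar>B\<bar>" if "\<nu> \<in> holonomic l M" for \<nu>
  proof (cases "integrable \<nu> A")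
    case True
    interpret prob_space \<nu> using that by (simp add: holonomic_def)
    have "space \<nu> = hat_sft M"
      using that space_borel_of_hat_top[OF assms(1,2), of M]
      by (auto simp: holonomic_def dest: sets_eq_imp_space_eq)
    then show ?thesis
      using B by (intro integral_le_const True) (auto intro!: AE_I2 simp: abs_le_iff; force)
  next
    case False
    then show ?thesis by (simp add: not_integrable_integral_eq)
  qed
  then show "bdd_above ((\<lambda>\<mu>. \<integral>p. A p \<partial>\<mu>) ` holonomic l M)"
    by (auto intro!: bdd_aboveI2)
qed

text \<open>
  The measure giving equal weight to the pairs \<open>(y\<^sub>k, x\<^sub>k)\<close> along the chain is holonomic: \<open>\<tau>\<close> sends the
  \<open>k\<close>-th pair to \<open>x\<^sub>k\<^sub>+\<^sub>1\<close>, so the two integrals are averages of \<open>f\<close> over the same closed orbit, shifted by one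
  step. Its integral of \<open>A\<close> is therefore at most \<open>\<beta>\<close>, and this is the claim divided by the length.
\<close>

lemma closed_chain_cost_nonneg:
  assumes l: "0 < l" "l < 1"
    and B: "\<And>p. p \<in> hat_sft M \<Longrightarrow> \<bar>A p\<bar> \<le> B"
    and A: "continuous_map (hat_top l M) euclideanreal A"
    and ys: "chain M x ys" "chain_end x ys = x"
  shows "0 \<le> chain_cost (\<lambda>p. beta l M A - A p) x ys"
proof (cases "ys = []")
  case False
  define n where "n = length ys"
  define g where "g k = (ys ! k, chain_end x (take k ys))" for k
  define U where "U = uniform_count_measure {..<n}"
  define \<mu> where "\<mu> = distr U (borel_of_top (hat_top l M)) g"
  have n: "n > 0" using False by (simp add: n_def)
  interpret U: prob_space U
    unfolding U_def using n by (intro prob_space_uniform_count_measure) auto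
  have g: "g \<in> measurable U (borel_of_top (hat_top l M))"
    using chain_nth[OF ys(1)] space_borel_of_hat_top[OF l, of M]
    by (auto simp: U_def g_def n_def measurable_def space_uniform_count_measure
        sets_uniform_count_measure)
  have int: "(\<integral>p. f p \<partial>\<mu>) = (\<Sum>k<n. f (g k)) / n"
    if "continuous_map (hat_top l M) euclideanreal f" for f
  proof -
    have "(\<integral>p. f p \<partial>\<mu>) = (\<integral>k. f (g k) \<partial>U)"
      unfolding \<mu>_def by (rule integral_distr[OF g continuous_map_borel_of_top[OF that]])
    also have "\<dots> = (\<Sum>k<n. f (g k)) / n"
      unfolding U_def by (subst integral_uniform_count_measure) auto
    finally show ?thesis .
  qed
  have tau: "continuous_map (hat_top l M) (sft_top l M) tau"
    unfolding hat_top_def sft_top_def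
    by (intro continuous_map_nonexpansive Metric_space_hat_dist Metric_space_seq_dist
        tau_dist_le tau_in_sft l)
  have snd: "continuous_map (hat_top l M) (sft_top l M) snd"
    unfolding hat_top_def sft_top_def
    by (intro continuous_map_nonexpansive Metric_space_hat_dist Metric_space_seq_dist l)
      (auto simp: hat_sft_def hat_dist_def)
  have "\<mu> \<in> holonomic l M"
    unfolding holonomic_def
  proof (intro CollectI conjI allI impI)
    show "prob_space \<mu>" unfolding \<mu>_def by (rule U.prob_space_distr[OF g])
    show "sets \<mu> = sets (borel_of_top (hat_top l M))" by (simp add: \<mu>_def)
    fix f assume f: "continuous_map (sft_top l M) euclideanreal f"
    have "(\<Sum>k<n. f (tau (g k))) = (\<Sum>k<n. f (chain_end x (take (Suc k) ys)))"
      by (intro sum.cong) (auto simp: g_def n_def chain_end_take_Suc)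
    \<comment> \<open>The sums differ by the terms at the two ends, which are equal since the chain is closed.\<close>
    also have "\<dots> = (\<Sum>k<n. f (chain_end x (take k ys)))"
      using sum_lessThan_telescope[of "\<lambda>k. f (chain_end x (take k ys))" n] ys(2)
      by (simp add: sum_subtractf n_def)
    finally show "(\<integral>p. f (tau p) \<partial>\<mu>) = (\<integral>p. f (snd p) \<partial>\<mu>)"
      using int[of "\<lambda>p. f (tau p)"] int[of "\<lambda>p. f (snd p)"]
        continuous_map_compose[OF tau f] continuous_map_compose[OF snd f]
      by (simp add: o_def g_def)
  qed
  then have "(\<integral>p. A p \<partial>\<mu>) \<le> beta l M A"
    by (intro integral_holonomic_le_beta[OF l, where B = B] B)
  then have "(\<Sum>k<n. A (g k)) / n \<le> beta l M A"
    unfolding int[OF A] .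
  then have "(\<Sum>k<n. A (g k)) \<le> n * beta l M A"
    using n by (simp add: field_simps)
  then show ?thesis
    by (simp add: chain_cost_eq_sum sum_subtractf g_def n_def)
qed simp

section \<open>Closing chains by periodic points\<close>

lemma left_shift_funpow: "(left_shift ^^ k) x j = x (j + k)"
  by (induction k arbitrary: j) (auto simp: left_shift_def)

lemma openin_sft_first_symbol:
  assumes "0 < l" "l < 1"
  shows "openin (sft_top l M) {x \<in> sft M. x 0 = a}"
proof -
  interpret Metric_space "sft M" "seq_dist l" by (rule Metric_space_seq_dist[OF assms])
  show ?thesis
    unfolding sft_top_def openin_mtopology
  proof (intro conjI allI impI)
    fix x assume x: "x \<in> {x \<in> sft M. x 0 = a}"
    have "mball x 1 \<subseteq> {x \<in> sft M. x 0 = a}"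
    proof
      fix z assume "z \<in> mball x 1"
      then have z: "z \<in> sft M" "seq_dist l x z < 1" by auto
      then have "x 0 = z 0" using seq_dist_eq_1[of x z l] by auto
      then show "z \<in> {x \<in> sft M. x 0 = a}" using x z by simp
    qed
    then show "\<exists>r>0. mball x r \<subseteq> {x \<in> sft M. x 0 = a}"
      by (intro exI[of _ 1]) auto
  qed auto
qed

text \<open>
  Mixing enters through this irreducibility statement, applied to the open sets of points with a given
  first symbol. The bound \<open>m > 0\<close> matters: it gives every symbol that occurs a predecessor, and it keeps the
  period of the closing point positive.
\<close>

lemma mixing_connects:
  assumes "0 < l" "l < 1" and mix: "topologically_mixing (sft_top l M) left_shift"
    and x: "x \<in> sft M" and x': "x' \<in> sft M"
  shows "\<exists>w\<in>sft M. \<exists>m>0. w 0 = x 0 \<and> w m = x' 0"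
proof -
  let ?D = "{z \<in> sft M. z 0 = x 0}" and ?E = "{z \<in> sft M. z 0 = x' 0}"
  have "?D \<noteq> {}" "?E \<noteq> {}" using x x' by auto
  moreover note mix[unfolded topologically_mixing_def, rule_format, of ?D ?E]
  ultimately obtain K where "\<forall>k>K. (left_shift ^^ k) ` ?D \<inter> ?E \<noteq> {}"
    using openin_sft_first_symbol[OF assms(1,2), of M] by auto
  then have "(left_shift ^^ Suc K) ` ?D \<inter> ?E \<noteq> {}" by blast
  then obtain w where "w \<in> ?D" "(left_shift ^^ Suc K) w \<in> ?E" by blast
  then show ?thesis
    using left_shift_funpow[of "Suc K" w 0] by (intro bexI[of _ w] exI[of _ "Suc K"]) auto
qed

lemma sft_drop: "x \<in> sft M \<Longrightarrow> (\<lambda>j. x (j + k)) \<in> sft M"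
  by (auto simp: sft_def)

text \<open>
  A symbol that occurs in \<open>\<Sigma>\<close> is reached from itself in a positive number of steps, so it has a predecessor
  that again occurs in \<open>\<Sigma>\<close>; dependent choice then builds the infinite past.
\<close>

lemma dual_sft_extends:
  assumes conn: "\<And>x x'. x \<in> sft M \<Longrightarrow> x' \<in> sft M \<Longrightarrow> \<exists>w\<in>sft M. \<exists>m>0. w 0 = x 0 \<and> w m = x' 0"
    and x: "x \<in> sft M"
  shows "\<exists>y\<in>dual_sft M. y 0 = x 0"
proof -
  have step: "\<exists>b'. (\<exists>z\<in>sft M. z 0 = b') \<and> M $ b' $ b = 1" if b: "\<exists>z\<in>sft M. z 0 = b" for b
  proof -
    obtain z where z: "z \<in> sft M" "z 0 = b" using b by auto
    obtain w m where w: "w \<in> sft M" "m > 0" "w m = b"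
      using conn[OF z(1) z(1)] z(2) by auto
    then obtain k where k: "m = Suc k" by (cases m) auto
    have "(\<lambda>j. w (j + k)) \<in> sft M" by (rule sft_drop[OF w(1)])
    moreover have "M $ w k $ b = 1" using w k by (auto simp: sft_def)
    ultimately show ?thesis by (intro exI[of _ "w k"] conjI bexI[of _ "\<lambda>j. w (j + k)"]) auto
  qed
  obtain y where "y 0 = x 0 \<and> (\<forall>n. (\<exists>z\<in>sft M. z 0 = y n) \<and> M $ y (Suc n) $ y n = 1)"
  proof -
    have "\<exists>f. \<forall>n. ((\<exists>z\<in>sft M. z 0 = f n) \<and> (n = 0 \<longrightarrow> f n = x 0)) \<and> M $ f (Suc n) $ f n = 1"
      by (rule dependent_nat_choice) (use x step in auto)
    then show ?thesis using that by metis
  qed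
  then show ?thesis by (auto simp: dual_sft_def)
qed

text \<open>
  The shift is undone by prepending the lost symbols again, each through some dual point that starts with it.
\<close>

lemma chain_undo_shift:
  assumes ext: "\<And>x. x \<in> sft M \<Longrightarrow> \<exists>y\<in>dual_sft M. y 0 = x 0"
    and p: "p \<in> sft M"
  shows "\<exists>zs. length zs = m \<and> chain M (\<lambda>j. p (j + m)) zs \<and> chain_end (\<lambda>j. p (j + m)) zs = p"
proof (induction m)
  case 0
  show ?case by (intro exI[of _ "[]"]) simp
next
  case (Suc m)
  then obtain zs where zs: "length zs = m" "chain M (\<lambda>j. p (j + m)) zs"
    "chain_end (\<lambda>j. p (j + m)) zs = p" by auto
  obtain y where y: "y \<in> dual_sft M" "y 0 = p m"
    using ext[OF sft_drop[OF p, of m]] by auto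
  have "tau (y, \<lambda>j. p (j + Suc m)) = (\<lambda>j. p (j + m))"
    using y by (auto simp: tau_def fun_eq_iff split: nat.splits)
  moreover have "(y, \<lambda>j. p (j + Suc m)) \<in> hat_sft M"
    using y sft_drop[OF p, of "Suc m"] p by (simp add: hat_sft_def sft_def)
  ultimately show ?case using zs by (intro exI[of _ "y # zs"]) simp
qed

text \<open>
  The periodic point repeats the block \<open>w\<^sub>0 \<dots> w\<^sub>m\<^sub>-\<^sub>1 e\<^sub>0 \<dots> e\<^sub>n\<^sub>-\<^sub>1\<close>, where \<open>e\<close> is the end of the chain, whose first
  \<open>n\<close> symbols are those that the chain prepends. The block is admissible inside because \<open>w\<^sub>m = e\<^sub>0\<close>, and
  cyclically because \<open>e\<^sub>n = x\<^sub>0 = w\<^sub>0\<close>. Prepending \<open>e\<^sub>0 \<dots> e\<^sub>n\<^sub>-\<^sub>1\<close> to \<open>p\<close> moves back by \<open>n\<close> symbols in a sequence of period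
  \<open>m + n\<close>, hence agrees with moving forward by \<open>m\<close>.
\<close>

lemma chain_closing_point:
  assumes x: "x \<in> sft M" and ys: "chain M x ys"
    and w: "w \<in> sft M" "w 0 = x 0" "w m = chain_end x ys 0" "m > 0"
  shows "\<exists>p\<in>sft M. p 0 = x 0 \<and> chain_end p ys = (\<lambda>j. p (j + m))"
proof -
  define n where "n = length ys"
  define e where "e = chain_end x ys"
  define p where "p j = (let i = j mod (m + n) in if i < m then w i else e (i - m))" for j
  have e: "e \<in> sft M" unfolding e_def by (rule chain_end_in_sft[OF ys x])
  have en: "e n = x 0" using chain_end_tail[of x ys 0] by (simp add: e_def n_def)
  have "M $ p j $ p (Suc j) = 1" for j
  proof -
    define i where "i = j mod (m + n)"
    have pj: "p j = (if i < m then w i else e (i - m))"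
      by (simp only: p_def i_def Let_def)
    have i: "i < m + n" using w(4) by (simp add: i_def)
    have eS: "M $ e k $ e (Suc k) = 1" and wS: "M $ w k $ w (Suc k) = 1" for k
      using e w(1) by (auto simp: sft_def)
    show ?thesis
    proof (cases "Suc i = m + n")
      case True
      then have S: "Suc j mod (m + n) = 0" by (simp add: i_def mod_Suc)
      then have "p (Suc j) = x 0" using w by (simp add: p_def)
      moreover have "M $ p j $ x 0 = 1"
      proof (cases "i < m")
        case t: True
        then have "n = 0" "Suc i = m" using True by auto
        then show ?thesis
          using wS[of i] t en w by (simp add: pj e_def)
      next
        case False
        then have "Suc (i - m) = n" using True by simp
        then show ?thesis
          using eS[of "i - m"] False en by (simp add: pj)
      qed
      ultimately show ?thesis by simp
    next
      case False
      then have S: "Suc j mod (m + n) = Suc i" by (simp add: i_def mod_Suc)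
      consider "Suc i < m" | "Suc i = m" | "m \<le> i" by linarith
      then show ?thesis
      proof cases
        case 1
        then show ?thesis using wS[of i] S by (simp add: p_def[of "Suc j"] pj)
      next
        case 2
        then show ?thesis
          using wS[of i] S w(3) by (simp add: p_def[of "Suc j"] pj e_def)
      next
        case 3
        then show ?thesis
          using eS[of "i - m"] S by (simp add: p_def[of "Suc j"] pj Suc_diff_le)
      qed
    qed
  qed
  then have p: "p \<in> sft M" by (simp add: sft_def)
  have "chain_end p ys j = p (j + m)" for j
  proof (cases "j < n")
    case True
    then have "chain_end p ys j = e j"
      unfolding e_def n_def by (rule chain_end_prefix)
    then show ?thesis using True by (simp add: p_def)
  next
    case False
    then have "chain_end p ys j = p (j - n)"
      using chain_end_tail[of p ys "j - n"] by (simp add: n_def)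
    also have "\<dots> = p (j - n + (m + n))" by (simp add: p_def)
    also have "j - n + (m + n) = j + m" using False by simp
    finally show ?thesis .
  qed
  moreover have "p 0 = x 0" using w by (simp add: p_def)
  ultimately show ?thesis using p by (intro bexI[of _ p]) auto
qed

text \<open>
  Whether a length \<open>m\<close> works depends only on the two first symbols, of which there are finitely many.
\<close>

lemma bounded_connections:
  assumes conn: "\<And>x x'. x \<in> sft M \<Longrightarrow> x' \<in> sft M \<Longrightarrow> \<exists>w\<in>sft M. \<exists>m>0. w 0 = x 0 \<and> w m = x' 0"
  shows "\<exists>N::nat. \<forall>x\<in>sft M. \<forall>x'\<in>sft M. \<exists>w\<in>sft M. \<exists>m>0. m \<le> N \<and> w 0 = x 0 \<and> w m = x' 0"
proof -
  define P where "P a b m \<longleftrightarrow> (\<exists>w\<in>sft M. m > 0 \<and> w 0 = a \<and> w m = b)" for a b and m :: nat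
  define t where "t ab = (SOME m. P (fst ab) (snd ab) m)" for ab
  have "\<exists>w\<in>sft M. \<exists>m>0. m \<le> Max (range t) \<and> w 0 = x 0 \<and> w m = x' 0"
    if "x \<in> sft M" "x' \<in> sft M" for x x'
  proof -
    have "\<exists>m. P (x 0) (x' 0) m" using conn[OF that] unfolding P_def by blast
    then have "P (x 0) (x' 0) (t (x 0, x' 0))" unfolding t_def by (simp add: someI_ex)
    moreover have "t (x 0, x' 0) \<le> Max (range t)" by (intro Max_ge) auto
    ultimately show ?thesis unfolding P_def by blast
  qed
  then show ?thesis by blast
qed

section \<open>Uniform bounds and Hoelder regularity of the optimal cost\<close>

text \<open>
  The chain is transferred to the closing point \<open>p\<close>, at cost at most \<open>H\<close>, and completed there to a closed chain
  by at most \<open>N\<close> further branches, each of cost at most \<open>D\<close>. Since the closed chain has nonnegative cost, the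
  original one costs at least \<open>- (N D + H)\<close>.
\<close>

lemma chain_cost_bounded_below:
  assumes l: "0 < l" "l < 1" and \<theta>: "0 < \<theta>"
    and mix: "topologically_mixing (sft_top l M) left_shift"
    and A: "holder_on (hat_sft M) (hat_dist l) \<theta> A"
  shows "\<exists>R. \<forall>x\<in>sft M. \<forall>ys. chain M x ys \<longrightarrow> - R \<le> chain_cost (\<lambda>p. beta l M A - A p) x ys"
proof -
  define c where "c p = beta l M A - A p" for p
  have conn: "\<exists>w\<in>sft M. \<exists>m>0. w 0 = x 0 \<and> w m = x' 0" if "x \<in> sft M" "x' \<in> sft M" for x x'
    by (rule mixing_connects[OF l mix that])
  have ext: "\<exists>y\<in>dual_sft M. y 0 = x 0" if "x \<in> sft M" for x
    by (rule dual_sft_extends[OF _ that]) (rule conn)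
  obtain N where N: "\<And>x x'. x \<in> sft M \<Longrightarrow> x' \<in> sft M \<Longrightarrow>
      \<exists>w\<in>sft M. \<exists>m>0. m \<le> (N::nat) \<and> w 0 = x 0 \<and> w m = x' 0"
    using bounded_connections[of M] conn by blast
  obtain B where B: "\<And>p. p \<in> hat_sft M \<Longrightarrow> \<bar>A p\<bar> \<le> B"
    using holder_on_bounded[OF A] \<theta> hat_dist_nonneg[OF l(1)] hat_dist_le_1[OF l]
    by (metis less_imp_le)
  have contA: "continuous_map (hat_top l M) euclideanreal A"
    unfolding hat_top_def by (rule holder_on_continuous_map[OF Metric_space_hat_dist[OF l] \<theta> A])
  obtain H where H: "H \<ge> 0" and change: "\<And>x x' ys. chain M x ys \<Longrightarrow> x \<in> sft M \<Longrightarrow>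
      x' \<in> sft M \<Longrightarrow> x 0 = x' 0 \<Longrightarrow> chain M x' ys \<and>
      \<bar>chain_cost c x ys - chain_cost c x' ys\<bar> \<le> H * seq_dist l x x' powr \<theta>"
    using holder_cost_change_start[OF l \<theta> A] unfolding c_def by metis
  define D where "D = \<bar>beta l M A\<bar> + \<bar>B\<bar>"
  have "- (real N * D + H) \<le> chain_cost c x ys" if x: "x \<in> sft M" and ys: "chain M x ys" for x ys
  proof -
    obtain w m where w: "w \<in> sft M" "w 0 = x 0" "w m = chain_end x ys 0" "m > 0" and mN: "m \<le> N"
      using N[OF x chain_end_in_sft[OF ys x]] by blast
    obtain p where p: "p \<in> sft M" "p 0 = x 0" "chain_end p ys = (\<lambda>j. p (j + m))"
      using chain_closing_point[OF x ys w] by blast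
    obtain zs where zs: "length zs = m" "chain M (\<lambda>j. p (j + m)) zs"
        "chain_end (\<lambda>j. p (j + m)) zs = p"
      using chain_undo_shift[of M p m] ext p(1) by blast
    have pys: "chain M p ys" "\<bar>chain_cost c x ys - chain_cost c p ys\<bar> \<le> H * seq_dist l x p powr \<theta>"
      using change[OF ys x p(1)] p(2) by auto
    have "0 \<le> chain_cost c p (ys @ zs)"
      unfolding c_def using zs p pys
      by (intro closed_chain_cost_nonneg[OF l _ contA, where B = B] B)
        (auto simp: chain_append chain_end_append)
    moreover have "chain_cost c (chain_end p ys) zs \<le> real (length zs) * D"
    proof (rule chain_cost_le)
      show "chain M (chain_end p ys) zs" using zs p by simp
      show "c q \<le> D" if "q \<in> hat_sft M" for q
        using B[OF that] unfolding c_def D_def by linarith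
    qed
    moreover have "real (length zs) * D \<le> real N * D"
      using mN zs by (intro mult_right_mono) (auto simp: D_def)
    moreover have "H * seq_dist l x p powr \<theta> \<le> H * 1"
      using \<theta> seq_dist_nonneg[OF l(1), of x p] seq_dist_le_1[OF l, of x p]
      by (intro mult_left_mono H powr_le1) auto
    ultimately show ?thesis using pys(2) unfolding chain_cost_append by linarith
  qed
  then show ?thesis unfolding c_def by blast
qed

text \<open>
  When the first symbols agree, the infima are compared term by term along the same chains. Points with
  different first symbols are at distance \<open>1\<close>, and there the two infima both lie between \<open>-R\<close> and \<open>0\<close>.
\<close>

lemma holder_on_best_cost:
  assumes R: "\<And>x ys. x \<in> sft M \<Longrightarrow> chain M x ys \<Longrightarrow> - R \<le> chain_cost c x ys"
    and change: "\<And>x x' ys. chain M x ys \<Longrightarrow> x \<in> sft M \<Longrightarrow> x' \<in> sft M \<Longrightarrow> x 0 = x' 0 \<Longrightarrow>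
      chain M x' ys \<and> \<bar>chain_cost c x ys - chain_cost c x' ys\<bar> \<le> H * seq_dist l x x' powr \<theta>"
  shows "holder_on (sft M) (seq_dist l) \<theta> (best_cost M c)"
  unfolding holder_on_def
proof (intro exI[of _ "max H R"] ballI)
  have lower: "best_cost M c x \<le> chain_cost c x ys" if "x \<in> sft M" "chain M x ys" for x ys
    using best_cost_le[OF _ that(2)] R[OF that(1)] by blast
  have near: "best_cost M c x - best_cost M c x' \<le> H * seq_dist l x x' powr \<theta>"
    if "x \<in> sft M" "x' \<in> sft M" "x 0 = x' 0" for x x'
  proof -
    have "best_cost M c x - H * seq_dist l x x' powr \<theta> \<le> best_cost M c x'"
    proof (rule best_cost_greatest)
      fix ys assume ys: "chain M x' ys"
      show "best_cost M c x - H * seq_dist l x x' powr \<theta> \<le> chain_cost c x' ys"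
        using change[OF ys that(2,1)] lower[OF that(1), of ys] that(3) seq_dist_commute[of l x x']
        by (simp add: abs_le_iff)
    qed
    then show ?thesis by simp
  qed
  fix x x' assume x: "x \<in> sft M" "x' \<in> sft M"
  show "\<bar>best_cost M c x - best_cost M c x'\<bar> \<le> max H R * seq_dist l x x' powr \<theta>"
  proof (cases "x 0 = x' 0")
    case True
    have "H * seq_dist l x x' powr \<theta> \<le> max H R * seq_dist l x x' powr \<theta>"
      by (intro mult_right_mono) auto
    then show ?thesis
      using near[of x x'] near[of x' x] x True seq_dist_commute[of l x x'] by simp
  next
    case False
    have "- R \<le> best_cost M c x" "- R \<le> best_cost M c x'"
      using R x by (auto intro: best_cost_greatest)
    moreover have "best_cost M c x \<le> 0" "best_cost M c x' \<le> 0"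
      using lower[of _ "[]"] x by auto
    ultimately show ?thesis using False by (simp add: seq_dist_eq_1)
  qed
qed

section \<open>The maximal nonpositive sub-action\<close>

theorem proposition3:
  fixes M :: "nat ^ 'r::finite ^ 'r"
    and l \<theta> :: real
    and A :: "(nat \<Rightarrow> 'r) \<times> (nat \<Rightarrow> 'r) \<Rightarrow> real"
  assumes "zero_one_matrix M"
    and "sft M \<noteq> {}"
    and "0 < l" and "l < 1"
    and "0 < \<theta>"
    and "topologically_mixing (sft_top l M) left_shift"
    and "holder_on (hat_sft M) (hat_dist l) \<theta> A"
  shows "\<exists>uA. sub_action l M A uA
            \<and> holder_on (sft M) (seq_dist l) \<theta> uA
            \<and> (\<forall>x\<in>sft M. uA x \<le> 0)
            \<and> (\<forall>u. sub_action l M A u \<and> (\<forall>x\<in>sft M. u x \<le> 0) \<longrightarrow> (\<forall>x\<in>sft M. u x \<le> uA x))"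
proof -
  note l = \<open>0 < l\<close> \<open>l < 1\<close>
  define c where "c = (\<lambda>p. beta l M A - A p)"
  obtain R where R: "\<And>x ys. x \<in> sft M \<Longrightarrow> chain M x ys \<Longrightarrow> - R \<le> chain_cost c x ys"
    using chain_cost_bounded_below[OF l assms(5-7)] unfolding c_def by blast
  obtain H where H: "\<And>x x' ys. chain M x ys \<Longrightarrow> x \<in> sft M \<Longrightarrow>
      x' \<in> sft M \<Longrightarrow> x 0 = x' 0 \<Longrightarrow> chain M x' ys \<and>
      \<bar>chain_cost c x ys - chain_cost c x' ys\<bar> \<le> H * seq_dist l x x' powr \<theta>"
    using holder_cost_change_start[OF l assms(5,7)] unfolding c_def by metis
  have holder: "holder_on (sft M) (seq_dist l) \<theta> (best_cost M c)"
    using R H by (rule holder_on_best_cost)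
  have "continuous_map (sft_top l M) euclideanreal (best_cost M c)"
    unfolding sft_top_def
    by (rule holder_on_continuous_map[OF Metric_space_seq_dist[OF l] assms(5) holder])
  moreover have "best_cost M c x \<le> best_cost M c (tau (y, x)) - A (y, x) + beta l M A"
    if yx: "(y, x) \<in> hat_sft M" for y x
  proof -
    have "x \<in> sft M" using yx by (simp add: hat_sft_def)
    then have "best_cost M c x \<le> c (y, x) + best_cost M c (tau (y, x))"
      by (intro best_cost_step[OF R yx])
    then show ?thesis by (simp add: c_def)
  qed
  ultimately have "sub_action l M A (best_cost M c)" unfolding sub_action_def by blast
  moreover have "best_cost M c x \<le> 0" if "x \<in> sft M" for x
  proof -
    have "best_cost M c x \<le> chain_cost c x []" by (rule best_cost_le[OF R[OF that]]) auto
    then show ?thesis by simp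
  qed
  moreover have "v x \<le> best_cost M c x"
    if v: "sub_action l M A v" "\<forall>x\<in>sft M. v x \<le> 0" and x: "x \<in> sft M" for v x
    unfolding c_def using sub_action_le_chain_cost[OF v(1) _ _ x] v(2)
    by (intro best_cost_greatest) auto
  ultimately show ?thesis using holder by blast
qed

end
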